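(* Define the formal power series $$G(q):=\sum_{n\ge 0}\frac{q^{n^2}}{(q;q)_n},\qquad H(q):=\sum_{n\ge 0}\frac{q^{n(n+1)}}{(q;q)_n}.$$ Then, as formal power series in $q$, $$G(q)=\frac{1}{(q;q^5)_\infty\,(q^4;q^5)_\infty}\qquad\text{and}\qquad H(q)=\frac{1}{(q^2;q^5)_\infty\,(q^3;q^5)_\infty}.$$
   Context: The $q$-Pochhammer symbols are $(a;q)_n:=\prod_{j=0}^{n-1}(1-aq^j)$ and $(a;q)_\infty:=\prod_{j=0}^{\infty}(1-aq^j)$; thus for instance $(q^4;q^5)_\infty=\prod_{j\ge 0}(1-q^{4+5j})$. All identities are in the ring of formal power series $\mathbb{Z}[[q]]$, where infinite sums and products converge in the $q$-adic topology, and all denominators are power series with constant term $1$, hence invertible. *)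

theory Defs
  imports "HOL-Analysis.Analysis" "HOL-Computational_Algebra.Formal_Power_Series"
begin

text \<open>
  Infinite sums and products of formal power series are the library's \<^const>\<open>suminf\<close> and
  \<^const>\<open>prodinf\<close>, taken with respect to the metric of \<^typ>\<open>int fps\<close>, which induces the
  adic topology of the ideal generated by the variable (cf. \<open>tendsto_fps_iff\<close>).
\<close>

definition qpoch :: "'a::comm_ring_1 \<Rightarrow> 'a \<Rightarrow> nat \<Rightarrow> 'a" where
  "qpoch a q n = (\<Prod>j<n. 1 - a * q ^ j)"

definition qpoch_inf :: "'a::{t2_space, comm_ring_1} \<Rightarrow> 'a \<Rightarrow> 'a" where
  "qpoch_inf a q = (\<Prod>j. 1 - a * q ^ j)"

text \<open>
  Since \<^typ>\<open>int\<close> has no \<^const>\<open>inverse\<close> operation, the library's \<^const>\<open>inverse\<close> is not available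
  on \<^typ>\<open>int fps\<close>. The following is the reciprocal of a series with constant term 1.
\<close>

definition fps_recip :: "int fps \<Rightarrow> int fps" where
  "fps_recip f = fps_right_inverse f 1"

definition RR_G :: "int fps" where
  "RR_G = (\<Sum>n. fps_X ^ (n ^ 2) * fps_recip (qpoch fps_X fps_X n))"

definition RR_H :: "int fps" where
  "RR_H = (\<Sum>n. fps_X ^ (n * (n + 1)) * fps_recip (qpoch fps_X fps_X n))"

text \<open>The reciprocals, sums and products above are genuine.\<close>

lemma fps_recip_mult:
  assumes "fps_nth f 0 = 1"
  shows "f * fps_recip f = 1"
  unfolding fps_recip_def using assms by (intro fps_right_inverse) simp

lemma fps_recip_unique:
  assumes "f * g = 1" and "fps_nth f 0 = 1"
  shows "g = fps_recip f"
  by (metis assms fps_recip_mult mult.commute mult.left_commute mult.right_neutral)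

lemma qpoch_nth_0: "fps_nth (qpoch (fps_X :: int fps) fps_X n) 0 = 1"
  unfolding qpoch_def by (induction n) auto

lemma summable_fpsI:
  fixes f :: "nat \<Rightarrow> int fps"
  assumes "\<And>n k. k < n \<Longrightarrow> fps_nth (f n) k = 0"
  shows "summable f"
proof -
  have "f sums Abs_fps (\<lambda>k. \<Sum>i<Suc k. fps_nth (f i) k)"
    unfolding sums_def
  proof (rule tendsto_fpsI)
    fix k
    have "fps_nth (\<Sum>i<n. f i) k = (\<Sum>i<Suc k. fps_nth (f i) k)" if "n \<ge> Suc k" for n
      unfolding fps_sum_nth
      by (rule sum.mono_neutral_right) (use that assms in auto)
    then show "\<forall>\<^sub>F n in sequentially. fps_nth (\<Sum>i<n. f i) k =
                 fps_nth (Abs_fps (\<lambda>k. \<Sum>i<Suc k. fps_nth (f i) k)) k"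
      unfolding eventually_sequentially by auto
  qed
  then show ?thesis by (auto simp: summable_def)
qed

lemma summable_RR_G:
  "summable (\<lambda>n. fps_X ^ (n ^ 2) * fps_recip (qpoch fps_X fps_X n))"
proof (rule summable_fpsI)
  fix n k :: nat
  assume "k < n"
  moreover have "n \<le> n ^ 2" by (simp add: power2_eq_square)
  ultimately show "fps_nth (fps_X ^ (n ^ 2) * fps_recip (qpoch fps_X fps_X n)) k = 0"
    by (simp add: fps_X_power_mult_nth)
qed

lemma summable_RR_H:
  "summable (\<lambda>n. fps_X ^ (n * (n + 1)) * fps_recip (qpoch fps_X fps_X n))"
proof (rule summable_fpsI)
  fix n k :: nat
  assume "k < n"
  moreover have "n \<le> n * (n + 1)" by simp
  ultimately show "fps_nth (fps_X ^ (n * (n + 1)) * fps_recip (qpoch fps_X fps_X n)) k = 0"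
    unfolding fps_X_power_mult_nth by simp
qed

lemma has_prod_qpoch_inf:
  assumes "c > 0" and "d > 0"
  shows "(\<lambda>j. 1 - fps_X ^ c * (fps_X ^ d) ^ j) has_prod qpoch_inf (fps_X ^ c) (fps_X ^ d :: int fps)"
    and "fps_nth (qpoch_inf (fps_X ^ c) (fps_X ^ d :: int fps)) 0 = 1"
proof -
  define f :: "nat \<Rightarrow> int fps" where "f = (\<lambda>j. 1 - fps_X ^ c * (fps_X ^ d) ^ j)"
  have f: "f j = 1 - fps_X ^ (c + d * j)" for j
    by (simp add: f_def power_add power_mult)
  have step: "fps_nth (\<Prod>i\<le>n. f i) k = fps_nth (\<Prod>i\<le>k. f i) k" if "n \<ge> k" for n k
    using that
  proof (induction n rule: dec_induct)
    case (step n)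
    have "n \<le> d * n"
      using assms by (cases d) auto
    then have "k < c + d * Suc n"
      using step.hyps assms unfolding mult_Suc_right by linarith
    then have "fps_nth ((\<Prod>i\<le>n. f i) * fps_X ^ (c + d * Suc n)) k = 0"
      unfolding fps_X_power_mult_right_nth by simp
    then show ?case
      using step.IH by (simp add: f right_diff_distrib del: mult_Suc_right)
  qed simp
  define p where "p = Abs_fps (\<lambda>k. fps_nth (\<Prod>i\<le>k. f i) k)"
  have p0: "fps_nth p 0 = 1"
    using assms by (simp add: p_def f)
  have "(\<lambda>n. \<Prod>i\<le>n. f i) \<longlonglongrightarrow> p"
  proof (rule tendsto_fpsI)
    fix k
    show "\<forall>\<^sub>F n in sequentially. fps_nth (\<Prod>i\<le>n. f i) k = fps_nth p k"
      unfolding eventually_sequentially p_def by (auto intro: step)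
  qed
  moreover have "p \<noteq> 0" using p0 by auto
  ultimately have hp: "f has_prod p"
    by (simp add: has_prod_def raw_has_prod_def)
  then have "p = qpoch_inf (fps_X ^ c) (fps_X ^ d)"
    unfolding qpoch_inf_def f_def by (rule has_prod_unique)
  then show "(\<lambda>j. 1 - fps_X ^ c * (fps_X ^ d) ^ j) has_prod qpoch_inf (fps_X ^ c) (fps_X ^ d :: int fps)"
    and "fps_nth (qpoch_inf (fps_X ^ c) (fps_X ^ d :: int fps)) 0 = 1"
    using hp p0 by (simp_all add: f_def)
qed

end

theory Submission
  imports Defs
begin

text \<open>
  The proof follows Bressoud. Let \<open>r\<^sub>d(n) = 1 / (q\<^sup>d; q\<^sup>d)\<^sub>n\<close>, understood as \<open>0\<close> for \<open>n < 0\<close>,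
  and consider for \<open>e \<in> {0, 1}\<close> the finite theta sums
  \<open>\<Sum>\<^sub>s (-1)\<^sup>s q^(a s(s+1)/2 + b s(s-1)/2) r\<^sub>d(N - s) r\<^sub>d(N + s + e)\<close>.
  For \<open>d = a + b\<close> they factor (a finite Jacobi triple product), by a recursion that alternates
  between \<open>e = 0\<close> and \<open>e = 1\<close>. For \<open>d = 1\<close>, the \<open>q\<close>-Vandermonde identity
  expresses the sum with theta weight multiplied by \<open>q^(s(s+e))\<close> through sums with the original weight.
  Two such steps lead from \<open>(a, b) = (1 - e, e)\<close>, where the theta sum is \<open>1\<close> if \<open>N = 0\<close> and
  \<open>0\<close> otherwise, to \<open>(3 + e, 2 - e)\<close>. Letting \<open>N\<close> tend to infinity there, and also in the
  triple product with the same \<open>(a, b)\<close> and \<open>d = 5\<close>, gives the theorem.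
\<close>

section \<open>Reciprocal Pochhammer symbols and their recurrences\<close>

definition rq :: "nat \<Rightarrow> int \<Rightarrow> int fps" where
  "rq d n = (if n < 0 then 0 else fps_recip (qpoch (fps_X ^ d) (fps_X ^ d) (nat n)))"

lemma rq_neg [simp]: "n < 0 \<Longrightarrow> rq d n = 0"
  by (simp add: rq_def)

lemma qpoch_power_nth_0: "c > 0 \<Longrightarrow> fps_nth (qpoch (fps_X ^ c) (fps_X ^ d :: int fps) n) 0 = 1"
  unfolding qpoch_def by (induction n) auto

lemma qpoch_Suc: "qpoch a q (Suc n) = qpoch a q n * (1 - a * q ^ n)"
  by (simp add: qpoch_def)

lemma qpoch_mult_rq:
  assumes "d > 0"
  shows "qpoch (fps_X ^ d) (fps_X ^ d) n * rq d (int n) = 1"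
  using fps_recip_mult[OF qpoch_power_nth_0[OF assms, of d n]] by (simp add: rq_def)

lemma rq_0 [simp]: "d > 0 \<Longrightarrow> rq d 0 = 1"
  using qpoch_mult_rq[of d 0] by (simp add: qpoch_def)

lemma one_minus_fps_X_power_neq_0: "d > 0 \<Longrightarrow> 1 - fps_X ^ d \<noteq> (0 :: int fps)"
proof -
  assume "d > 0"
  then have "fps_nth (1 - fps_X ^ d :: int fps) 0 \<noteq> fps_nth 0 0" by simp
  then show ?thesis by metis
qed

text \<open>Valid at every integer \<open>n\<close>: at \<open>n = 0\<close> the factor
  \<open>1 - fps_X ^ 0\<close> vanishes, matching the convention that \<open>rq\<close> is 0 at
  negative arguments. This is what spares the later sums any boundary terms.\<close>

lemma rq_step:
  assumes "d > 0"
  shows "(1 - fps_X ^ (d * nat n)) * rq d n = rq d (n - 1)"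
proof (cases "n \<le> 0")
  case True
  then show ?thesis by (cases "n = 0") auto
next
  case False
  then obtain m where m: "n = int (Suc m)"
    by (metis gr0_implies_Suc not_le zero_less_imp_eq_int)
  let ?p = "qpoch (fps_X ^ d) (fps_X ^ d :: int fps)"
  have "?p m * ((1 - fps_X ^ (d * Suc m)) * rq d n) = ?p (Suc m) * rq d n"
    by (simp add: qpoch_Suc power_add power_mult algebra_simps)
  also have "\<dots> = ?p m * rq d (n - 1)"
    using qpoch_mult_rq[OF assms, of "Suc m"] qpoch_mult_rq[OF assms, of m] by (simp add: m)
  finally have "?p m * ((1 - fps_X ^ (d * Suc m)) * rq d n) = ?p m * rq d (n - 1)" .
  moreover have "?p m \<noteq> 0"
    using qpoch_mult_rq[OF assms, of m] by auto
  ultimately show ?thesis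
    unfolding m by (simp only: mult_cancel_left nat_int) blast
qed

text \<open>The \<open>q\<close>-Pascal rule in reciprocal form: write
  \<open>1 - q^(x+y) = (1 - q^x) + q^x (1 - q^y)\<close> and absorb each factor by
  \<open>rq_step\<close>. If \<open>x\<close> or \<open>y\<close> is negative, every term is 0, so
  truncation by \<open>nat\<close> does no harm.\<close>

lemma rq_split:
  assumes "d > 0"
  shows "(1 - fps_X ^ (d * nat (x + y))) * (rq d x * rq d y)
       = rq d (x - 1) * rq d y + fps_X ^ (d * nat x) * (rq d x * rq d (y - 1))"
proof (cases "x < 0 \<or> y < 0")
  case False
  then have "(1 - fps_X ^ (d * nat (x + y)) :: int fps)
      = (1 - fps_X ^ (d * nat x)) + fps_X ^ (d * nat x) * (1 - fps_X ^ (d * nat y))"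
    by (simp add: nat_add_distrib power_add algebra_simps)
  then have "(1 - fps_X ^ (d * nat (x + y))) * (rq d x * rq d y)
      = ((1 - fps_X ^ (d * nat x)) * rq d x) * rq d y
        + fps_X ^ (d * nat x) * (rq d x * ((1 - fps_X ^ (d * nat y)) * rq d y))"
    by (simp add: algebra_simps)
  then show ?thesis
    by (simp only: rq_step[OF assms])
qed auto

section \<open>The \<open>q\<close>-Vandermonde sum and the Bailey step\<close>

text \<open>Multiplying by \<open>1 - q^(n+1)\<close> and applying the Pascal rule to the first two
  reciprocals turns the sum for \<open>(n + 1, a)\<close> into the sum for
  \<open>(n, a + 1)\<close>; hence the induction on \<open>n\<close> with \<open>a\<close>
  arbitrary.\<close>

lemma rq_vandermonde:
  "(\<Sum>k\<le>n. fps_X ^ (k * (k + a)) * (rq 1 (int k) * rq 1 (int n - int k) * rq 1 (int k + int a)))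
     = rq 1 (int n) * rq 1 (int n + int a)"
proof (induction n arbitrary: a)
  case (Suc n)
  let ?t = "\<lambda>k. fps_X ^ (k * (k + a)) * (rq 1 (int k) * rq 1 (int (Suc n) - int k) * rq 1 (int k + int a))"
  let ?u = "\<lambda>k. fps_X ^ (k * (k + a)) * (rq 1 (int k - 1) * rq 1 (int (Suc n) - int k) * rq 1 (int k + int a))"
  let ?v = "\<lambda>k. fps_X ^ (k * (k + a)) * (fps_X ^ k * (rq 1 (int k) * rq 1 (int n - int k)) * rq 1 (int k + int a))"
  have split: "(1 - fps_X ^ Suc n) * ?t k = ?u k + ?v k" if "k \<le> Suc n" for k
  proof -
    have "(1 - fps_X ^ Suc n) * (rq 1 (int k) * rq 1 (int (Suc n) - int k))
       = rq 1 (int k - 1) * rq 1 (int (Suc n) - int k) + fps_X ^ k * (rq 1 (int k) * rq 1 (int n - int k))"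
      using rq_split[of 1 "int k" "int (Suc n) - int k"] that
      by (simp add: nat_add_distrib)
    then have "(1 - fps_X ^ Suc n) * ?t k = fps_X ^ (k * (k + a)) *
        ((rq 1 (int k - 1) * rq 1 (int (Suc n) - int k) + fps_X ^ k * (rq 1 (int k) * rq 1 (int n - int k)))
          * rq 1 (int k + int a))"
      by (metis (no_types, lifting) mult.assoc mult.left_commute)
    then show ?thesis by (simp add: algebra_simps)
  qed
  have "(1 - fps_X ^ Suc n) * (\<Sum>k\<le>Suc n. ?t k) = (\<Sum>k\<le>Suc n. ?u k) + (\<Sum>k\<le>Suc n. ?v k)"
    unfolding sum_distrib_left sum.distrib[symmetric] by (rule sum.cong) (use split in auto)
  \<comment> \<open>The \<open>k = 0\<close> term of \<open>?u\<close> and the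
    \<open>k = Suc n\<close> term of \<open>?v\<close> each contain \<open>rq 1 (-1) = 0\<close>, so
    both sums can be indexed by \<open>k \<le> n\<close>.\<close>
  also have "(\<Sum>k\<le>Suc n. ?u k) = (\<Sum>k\<le>n. ?u (Suc k))"
    by (subst sum.atMost_Suc_shift) simp
  also have "(\<Sum>k\<le>Suc n. ?v k) = (\<Sum>k\<le>n. ?v k)"
    by simp
  also have "(\<Sum>k\<le>n. ?u (Suc k)) + (\<Sum>k\<le>n. ?v k) = (\<Sum>k\<le>n. fps_X ^ (k * (k + Suc a)) *
      (rq 1 (int k) * rq 1 (int n - int k) * rq 1 (int k + int (Suc a))))"
    unfolding sum.distrib[symmetric]
  proof (rule sum.cong)
    fix k
    let ?c = "rq 1 (int k) * rq 1 (int n - int k)" and ?r = "rq 1 (int k + int (Suc a))"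
    have r: "rq 1 (int k + int a) = (1 - fps_X ^ (k + a + 1)) * ?r"
      using rq_step[of 1 "int k + int (Suc a)"] by (simp add: nat_add_distrib add.commute)
    have u: "?u (Suc k) = fps_X ^ (k * (k + Suc a)) * fps_X ^ (k + a + 1) * ?c * ?r"
      unfolding power_add[symmetric] by (simp add: algebra_simps)
    have v: "?v k = fps_X ^ (k * (k + Suc a)) * ?c * rq 1 (int k + int a)"
      by (simp add: power_add algebra_simps)
    \<comment> \<open>Here \<open>y = q^(k+a+1)\<close>: the part of \<open>?v k\<close> carrying
      \<open>y\<close> cancels \<open>?u (Suc k)\<close>.\<close>
    have "x * y * c * z + x * c * ((1 - y) * z) = x * (c * z)" for x y c z :: "int fps"
      by (simp add: algebra_simps)
    then show "?u (Suc k) + ?v k = fps_X ^ (k * (k + Suc a)) * (?c * ?r)"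
      unfolding u v unfolding r .
  qed simp
  also have "\<dots> = rq 1 (int n) * rq 1 (int n + int (Suc a))"
    by (rule Suc.IH)
  also have "\<dots> = (1 - fps_X ^ Suc n) * (rq 1 (int (Suc n)) * rq 1 (int (Suc n) + int a))"
  proof -
    have "(1 - fps_X ^ Suc n) * rq 1 (int (Suc n)) = rq 1 (int n)"
      using rq_step[of 1 "int (Suc n)"] by (simp add: nat_add_distrib)
    moreover have "int n + int (Suc a) = int (Suc n) + int a" by simp
    ultimately show ?thesis by (metis mult.assoc)
  qed
  finally have "(1 - fps_X ^ Suc n) * (\<Sum>k\<le>Suc n. ?t k)
     = (1 - fps_X ^ Suc n) * (rq 1 (int (Suc n)) * rq 1 (int (Suc n) + int a))" .
  then show ?case
    using one_minus_fps_X_power_neq_0[of "Suc n"] by (simp only: mult_cancel_left) auto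
qed simp

text \<open>Vandermonde with \<open>t = m + k\<close>, \<open>n = N - m\<close> and
  \<open>a = 2 * m + e\<close>. Terms with \<open>t < m\<close> vanish, and for \<open>m > N\<close>
  both sides are 0.\<close>

lemma rq_bailey_nat:
  "fps_X ^ (m * (m + e)) * (rq 1 (int N - int m) * rq 1 (int N + int m + int e))
    = (\<Sum>t\<le>N. fps_X ^ (t * (t + e)) * rq 1 (int N - int t) * (rq 1 (int t - int m) * rq 1 (int t + int m + int e)))"
    (is "_ = sum ?f _")
proof (cases "m \<le> N")
  case True
  then obtain n where N: "N = m + n" using le_Suc_ex by blast
  have "sum ?f {..N} = sum ?f {m..N}"
    by (rule sum.mono_neutral_right) auto
  also have "\<dots> = (\<Sum>k\<le>n. ?f (k + m))"
    using sum.shift_bounds_cl_nat_ivl[of ?f 0 m n] by (simp add: N add.commute atMost_atLeast0)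
  also have "\<dots> = (\<Sum>k\<le>n. fps_X ^ (m * (m + e)) * (fps_X ^ (k * (k + (2 * m + e))) *
      (rq 1 (int k) * rq 1 (int n - int k) * rq 1 (int k + int (2 * m + e)))))"
  proof (rule sum.cong)
    fix k
    have "fps_X ^ ((k + m) * (k + m + e)) = fps_X ^ (m * (m + e)) * (fps_X ^ (k * (k + (2 * m + e))) :: int fps)"
      unfolding power_add[symmetric] by (simp add: algebra_simps)
    then show "?f (k + m) = fps_X ^ (m * (m + e)) * (fps_X ^ (k * (k + (2 * m + e))) *
      (rq 1 (int k) * rq 1 (int n - int k) * rq 1 (int k + int (2 * m + e))))"
      by (simp add: N algebra_simps)
  qed simp
  also have "\<dots> = fps_X ^ (m * (m + e)) * (rq 1 (int n) * rq 1 (int n + int (2 * m + e)))"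
    by (simp only: sum_distrib_left[symmetric] rq_vandermonde)
  also have "\<dots> = fps_X ^ (m * (m + e)) * (rq 1 (int N - int m) * rq 1 (int N + int m + int e))"
    by (simp add: N algebra_simps)
  finally show ?thesis by simp
next
  case False
  then show ?thesis by (simp add: sum.neutral)
qed

text \<open>The reflection of \<open>s\<close> to \<open>- s - e\<close> swaps the two
  \<open>rq\<close> factors and fixes \<open>s * (s + e)\<close>, so negative \<open>s\<close>
  reduces to the natural case; \<open>e \<le> 1\<close> makes the reflected index
  nonnegative.\<close>

lemma rq_bailey:
  fixes s :: int
  assumes "e \<le> 1"
  shows "fps_X ^ nat (s * (s + int e)) * (rq 1 (int N - s) * rq 1 (int N + s + int e))
    = (\<Sum>t\<le>N. fps_X ^ (t * (t + e)) * rq 1 (int N - int t) * (rq 1 (int t - s) * rq 1 (int t + s + int e)))"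
proof (cases "s \<ge> 0")
  case True
  then obtain m where "s = int m" using nonneg_eq_int by blast
  then show ?thesis
    using rq_bailey_nat[of m e N] by (simp flip: of_nat_add of_nat_mult)
next
  case False
  define m where "m = nat (- s - int e)"
  have s: "s = - int m - int e" using False assms by (simp add: m_def)
  have "s * (s + int e) = int (m * (m + e))"
    by (simp add: s algebra_simps)
  then have n: "nat (s * (s + int e)) = m * (m + e)" by (simp only: nat_int)
  show ?thesis
    using rq_bailey_nat[of m e N] unfolding n by (simp add: s algebra_simps)
qed

section \<open>Theta weights and their finite sums\<close>

definition tri :: "int \<Rightarrow> nat" where
  "tri s = nat (s * (s + 1) div 2)"

text \<open>For every integer \<open>s\<close> the product \<open>s * (s + 1)\<close> is nonnegative
  and even, so neither \<open>nat\<close> nor \<open>div\<close> loses anything. In particular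
  \<open>tri (- s)\<close> is \<open>s(s-1)/2\<close>.\<close>

lemma int_tri: "2 * int (tri s) = s * (s + 1)"
proof -
  have "s * (s + 1) \<ge> 0"
    by (cases "s \<ge> 0") (auto intro: mult_nonneg_nonneg mult_nonpos_nonpos)
  moreover have "even (s * (s + 1))" by simp
  ultimately show ?thesis by (simp add: tri_def)
qed

definition theta_term :: "nat \<Rightarrow> nat \<Rightarrow> int \<Rightarrow> int fps" where
  "theta_term a b s = (if even s then 1 else -1) * fps_X ^ (a * tri s + b * tri (- s))"

lemma theta_term_mult_X:
  assumes "int n + int (a * tri s + b * tri (- s)) = int m + int (a * tri t + b * tri (- t))"
    and "odd (s - t)"
  shows "theta_term a b s * fps_X ^ n = - (fps_X ^ m * theta_term a b t)"
proof -
  have "n + (a * tri s + b * tri (- s)) = m + (a * tri t + b * tri (- t))"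
    using assms(1) by linarith
  then have "fps_X ^ n * fps_X ^ (a * tri s + b * tri (- s))
       = (fps_X ^ m * fps_X ^ (a * tri t + b * tri (- t)) :: int fps)"
    by (simp flip: power_add)
  then show ?thesis
    using assms(2) by (auto simp: theta_term_def mult_ac)
qed

text \<open>Doubling removes the halves, so that comparing theta exponents becomes a polynomial
  identity in \<open>s\<close>.\<close>

lemma int_theta_exponent:
  "2 * int (a * tri s + b * tri (- s)) = int (a + b) * s * s + (int a - int b) * s"
proof -
  have "2 * int (a * tri s + b * tri (- s)) = int a * (2 * int (tri s)) + int b * (2 * int (tri (- s)))"
    by simp
  then show ?thesis
    unfolding int_tri by (simp add: algebra_simps)
qed

text \<open>Quasi-periodicity of the theta weight: the power that \<open>rq_split\<close> produces
  for \<open>d = a + b\<close> moves the weight from \<open>s\<close> to \<open>s + 1\<close>,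
  leaving a factor independent of \<open>s\<close>. The next lemma is its mirror image.\<close>

lemma theta_term_up:
  assumes "int N + s + 1 \<ge> 0"
  shows "theta_term a b s * fps_X ^ ((a + b) * nat (int N + s + 1))
     = - (fps_X ^ (b + (a + b) * N) * theta_term a b (s + 1))"
proof (rule theta_term_mult_X)
  have "2 * int ((a + b) * nat (int N + s + 1)) = 2 * int (a + b) * (int N + s + 1)"
    using assms by simp
  then have "2 * (int ((a + b) * nat (int N + s + 1)) + int (a * tri s + b * tri (- s)))
     = 2 * (int (b + (a + b) * N) + int (a * tri (s + 1) + b * tri (- (s + 1))))"
    unfolding distrib_left[of 2] int_theta_exponent by (simp add: algebra_simps)
  then show "int ((a + b) * nat (int N + s + 1)) + int (a * tri s + b * tri (- s))
     = int (b + (a + b) * N) + int (a * tri (s + 1) + b * tri (- (s + 1)))"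
    by simp
qed simp

lemma theta_term_down:
  assumes "int N + 1 - s \<ge> 0"
  shows "theta_term a b s * fps_X ^ ((a + b) * nat (int N + 1 - s))
     = - (fps_X ^ (a + (a + b) * N) * theta_term a b (s - 1))"
proof (rule theta_term_mult_X)
  have "2 * int ((a + b) * nat (int N + 1 - s)) = 2 * int (a + b) * (int N + 1 - s)"
    using assms by simp
  then have "2 * (int ((a + b) * nat (int N + 1 - s)) + int (a * tri s + b * tri (- s)))
     = 2 * (int (a + (a + b) * N) + int (a * tri (s - 1) + b * tri (- (s - 1))))"
    unfolding distrib_left[of 2] int_theta_exponent by (simp add: algebra_simps)
  then show "int ((a + b) * nat (int N + 1 - s)) + int (a * tri s + b * tri (- s))
     = int (a + (a + b) * N) + int (a * tri (s - 1) + b * tri (- (s - 1)))"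
    by simp
qed simp

text \<open>Because \<open>s(s+e) = (1+e) s(s+1)/2 + (1-e) s(s-1)/2\<close>.\<close>

lemma theta_term_square:
  assumes "e \<le> 1"
  shows "theta_term a b s * fps_X ^ nat (s * (s + int e)) = theta_term (a + 1 + e) (b + 1 - e) s"
proof -
  have pos: "s * (s + int e) \<ge> 0"
  proof (cases "s \<ge> 0")
    case True
    then show ?thesis by (intro mult_nonneg_nonneg) simp_all
  next
    case False
    then have "s \<le> 0" "s + int e \<le> 0" using assms by simp_all
    then show ?thesis by (rule mult_nonpos_nonpos)
  qed
  then have sq: "int (nat (s * (s + int e))) = s * (s + int e)" by simp
  have "2 * (int (a * tri s + b * tri (- s)) + int (nat (s * (s + int e))))
      = 2 * int ((a + 1 + e) * tri s + (b + 1 - e) * tri (- s))"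
    using assms unfolding distrib_left[of 2] int_theta_exponent sq
    by (simp add: of_nat_diff algebra_simps)
  then have "(a + 1 + e) * tri s + (b + 1 - e) * tri (- s)
     = a * tri s + b * tri (- s) + nat (s * (s + int e))"
    unfolding of_nat_add[of "a * tri s + b * tri (- s)", symmetric] mult_cancel_left of_nat_eq_iff
    by (metis zero_neq_numeral)
  then show ?thesis
    by (simp add: theta_term_def power_add mult_ac)
qed

text \<open>The summand vanishes unless \<open>- N - e \<le> s \<le> N\<close>, so for
  \<open>e \<le> 1\<close> any \<open>M > N\<close> gives the full bilateral sum. Keeping
  \<open>M\<close> separate lets one range of \<open>s\<close> serve all values of \<open>N\<close>
  in the recursions and in the exchange of sums.\<close>

definition theta_sum :: "nat \<Rightarrow> nat \<Rightarrow> nat \<Rightarrow> nat \<Rightarrow> nat \<Rightarrow> nat \<Rightarrow> int fps" where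
  "theta_sum a b d e M N =
     (\<Sum>s\<in>{- int M..int M}. theta_term a b s * (rq d (int N - s) * rq d (int N + s + int e)))"

lemma sum_int_shift_up:
  fixes f :: "int \<Rightarrow> 'a::comm_monoid_add"
  assumes "f (- int M) = 0" and "f (int M + 1) = 0"
  shows "(\<Sum>s\<in>{- int M..int M}. f (s + 1)) = sum f {- int M..int M}"
proof -
  have "(\<Sum>s\<in>{- int M..int M}. f (s + 1)) = sum f {- int M + 1..int M + 1}"
    by (rule sum.reindex_bij_witness[of _ "\<lambda>s. s - 1" "\<lambda>s. s + 1"]) auto
  also have "\<dots> = sum f {- int M..int M + 1}"
  proof (rule sum.mono_neutral_left)
    have "{- int M..int M + 1} - {- int M + 1..int M + 1} \<subseteq> {- int M}" by auto
    then show "\<forall>s\<in>{- int M..int M + 1} - {- int M + 1..int M + 1}. f s = 0"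
      using assms by auto
  qed auto
  also have "\<dots> = sum f {- int M..int M}"
  proof (rule sum.mono_neutral_right)
    have "{- int M..int M + 1} - {- int M..int M} \<subseteq> {int M + 1}" by auto
    then show "\<forall>s\<in>{- int M..int M + 1} - {- int M..int M}. f s = 0"
      using assms by auto
  qed auto
  finally show ?thesis .
qed

lemma sum_int_shift_down:
  fixes f :: "int \<Rightarrow> 'a::comm_monoid_add"
  assumes "f (- int M - 1) = 0" and "f (int M) = 0"
  shows "(\<Sum>s\<in>{- int M..int M}. f (s - 1)) = sum f {- int M..int M}"
proof -
  have "(\<Sum>s\<in>{- int M..int M}. f (s - 1)) = sum (\<lambda>s. f (- s)) {- int M + 1..int M + 1}"
    by (rule sum.reindex_bij_witness[of _ "\<lambda>s. 1 - s" "\<lambda>s. 1 - s"]) auto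
  also have "\<dots> = (\<Sum>s\<in>{- int M..int M}. f (- (s + 1)))"
    by (rule sum.reindex_bij_witness[of _ "\<lambda>s. s + 1" "\<lambda>s. s - 1"]) auto
  also have "\<dots> = (\<Sum>s\<in>{- int M..int M}. f (- s))"
    using assms by (intro sum_int_shift_up) auto
  also have "\<dots> = sum f {- int M..int M}"
    by (rule sum.reindex_bij_witness[of _ uminus uminus]) auto
  finally show ?thesis .
qed

section \<open>The finite Jacobi triple product\<close>

lemma mult_split_left:
  fixes p :: "'a::comm_semiring_1"
  assumes "p * x = u + q * v"
  shows "p * (t * x) = t * u + t * q * v"
proof -
  have "p * (t * x) = t * (p * x)" by (simp only: mult_ac)
  then show ?thesis by (simp only: assms distrib_left mult.assoc)
qed

text \<open>Apply \<open>rq_split\<close> with \<open>x = N + s + 1\<close> and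
  \<open>y = N - s\<close>, whose sum \<open>2 * N + 1\<close> does not depend on \<open>s\<close>.
  By \<open>theta_term_up\<close> the second piece is the first one shifted by 1 and scaled by a
  constant, so the sum factors.\<close>

lemma theta_sum_odd:
  assumes "N < M" "a + b > 0"
  shows "(1 - fps_X ^ ((a + b) * (2 * N + 1))) * theta_sum a b (a + b) 1 M N
       = (1 - fps_X ^ (b + (a + b) * N)) * theta_sum a b (a + b) 0 M N"
proof -
  define d where "d = a + b"
  let ?f = "\<lambda>s. theta_term a b s * (rq d (int N - s) * rq d (int N + s))"
  let ?I = "{- int M..int M}"
  have "(1 - fps_X ^ (d * (2 * N + 1))) * (theta_term a b s * (rq d (int N - s) * rq d (int N + s + 1)))
      = ?f s - fps_X ^ (b + d * N) * ?f (s + 1)" for s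
  \<comment> \<open>For \<open>N + s + 1 < 0\<close> all three products contain an \<open>rq\<close>
    at a negative argument.\<close>
  proof (cases "int N + s + 1 \<ge> 0")
    case True
    have n: "nat (int N + s + 1 + (int N - s)) = 2 * N + 1" by simp
    have "(1 - fps_X ^ (d * (2 * N + 1))) * (rq d (int N + s + 1) * rq d (int N - s))
        = rq d (int N + s) * rq d (int N - s)
          + fps_X ^ (d * nat (int N + s + 1)) * (rq d (int N + s + 1) * rq d (int N - s - 1))"
      using rq_split[of d "int N + s + 1" "int N - s"] assms unfolding n by (simp add: d_def)
    from mult_split_left[OF this, of "theta_term a b s"] have "(1 - fps_X ^ (d * (2 * N + 1))) * (theta_term a b s * (rq d (int N - s) * rq d (int N + s + 1)))
       = ?f s + (theta_term a b s * fps_X ^ (d * nat (int N + s + 1))) * (rq d (int N + s + 1) * rq d (int N - s - 1))"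
      by (simp only: mult_ac)
    also have "\<dots> = ?f s - fps_X ^ (b + d * N) * ?f (s + 1)"
      unfolding d_def theta_term_up[OF True] by (simp add: algebra_simps)
    finally show ?thesis .
  qed simp
  then have "(1 - fps_X ^ (d * (2 * N + 1))) * theta_sum a b d 1 M N
      = (\<Sum>s\<in>?I. ?f s - fps_X ^ (b + d * N) * ?f (s + 1))"
    unfolding theta_sum_def sum_distrib_left by (intro sum.cong) simp_all
  also have "\<dots> = sum ?f ?I - fps_X ^ (b + d * N) * (\<Sum>s\<in>?I. ?f (s + 1))"
    by (simp only: sum_subtractf sum_distrib_left)
  also have "(\<Sum>s\<in>?I. ?f (s + 1)) = sum ?f ?I"
    \<comment> \<open>The two boundary terms contain \<open>rq\<close> at \<open>N - M\<close> and
      \<open>N - M - 1\<close>, negative because \<open>N < M\<close>.\<close>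
    by (rule sum_int_shift_up) (use assms in auto)
  finally show ?thesis
    by (simp add: theta_sum_def d_def algebra_simps)
qed

text \<open>The companion step, with \<open>x = N + 1 - s\<close>, \<open>y = N + s + 1\<close> and
  a downward shift of \<open>s\<close>.\<close>

lemma theta_sum_even:
  assumes "N < M" "a + b > 0"
  shows "(1 - fps_X ^ ((a + b) * (2 * N + 2))) * theta_sum a b (a + b) 0 M (Suc N)
       = (1 - fps_X ^ (a + (a + b) * N)) * theta_sum a b (a + b) 1 M N"
proof -
  define d where "d = a + b"
  let ?f = "\<lambda>s. theta_term a b s * (rq d (int N - s) * rq d (int N + s + 1))"
  let ?I = "{- int M..int M}"
  have "(1 - fps_X ^ (d * (2 * N + 2))) * (theta_term a b s * (rq d (int N + 1 - s) * rq d (int N + s + 1)))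
      = ?f s - fps_X ^ (a + d * N) * ?f (s - 1)" for s
  proof (cases "int N + 1 - s \<ge> 0")
    case True
    have n: "nat (int N + 1 - s + (int N + s + 1)) = 2 * N + 2"
      and m: "int N + 1 - s - 1 = int N - s" by simp_all
    have "(1 - fps_X ^ (d * (2 * N + 2))) * (rq d (int N + 1 - s) * rq d (int N + s + 1))
        = rq d (int N - s) * rq d (int N + s + 1)
          + fps_X ^ (d * nat (int N + 1 - s)) * (rq d (int N + 1 - s) * rq d (int N + s))"
      using rq_split[of d "int N + 1 - s" "int N + s + 1"] assms unfolding n m by (simp add: d_def)
    then have "(1 - fps_X ^ (d * (2 * N + 2))) * (theta_term a b s * (rq d (int N + 1 - s) * rq d (int N + s + 1)))
       = ?f s + (theta_term a b s * fps_X ^ (d * nat (int N + 1 - s))) * (rq d (int N + 1 - s) * rq d (int N + s))"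
      by (rule mult_split_left)
    also have "\<dots> = ?f s - fps_X ^ (a + d * N) * ?f (s - 1)"
      unfolding d_def theta_term_down[OF True] by (simp add: algebra_simps)
    finally show ?thesis .
  qed simp
  then have "(1 - fps_X ^ (d * (2 * N + 2))) * theta_sum a b d 0 M (Suc N)
      = (\<Sum>s\<in>?I. ?f s - fps_X ^ (a + d * N) * ?f (s - 1))"
    unfolding theta_sum_def sum_distrib_left by (intro sum.cong) (simp_all add: add_ac)
  also have "\<dots> = sum ?f ?I - fps_X ^ (a + d * N) * (\<Sum>s\<in>?I. ?f (s - 1))"
    by (simp only: sum_subtractf sum_distrib_left)
  also have "(\<Sum>s\<in>?I. ?f (s - 1)) = sum ?f ?I"
    by (rule sum_int_shift_down) (use assms in auto)
  finally show ?thesis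
    by (simp add: theta_sum_def d_def algebra_simps)
qed

lemma eq_mult_rq_Suc:
  assumes "d > 0" "(1 - fps_X ^ (d * Suc n)) * f = p * rq d (int n)"
  shows "f = p * rq d (int (Suc n))"
proof -
  have "(1 - fps_X ^ (d * Suc n)) * rq d (int (Suc n)) = rq d (int n)"
    using rq_step[OF assms(1), of "int (Suc n)"] unfolding nat_int by simp
  then have "(1 - fps_X ^ (d * Suc n)) * f = (1 - fps_X ^ (d * Suc n)) * (p * rq d (int (Suc n)))"
    unfolding assms(2) by (simp only: mult.left_commute)
  then show ?thesis
    using one_minus_fps_X_power_neq_0[of "d * Suc n"] assms(1) by (simp only: mult_cancel_left) auto
qed

text \<open>Each half-step adds one factor to one of the two products and one to the denominator, so
  induction alternates \<open>e = 0\<close>, \<open>e = 1\<close>, then \<open>e = 0\<close> at the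
  next \<open>N\<close>.\<close>

lemma theta_sum_eq:
  assumes "N < M" "a + b = d" "d > 0" "e \<le> 1"
  shows "theta_sum a b d e M N = qpoch (fps_X ^ a) (fps_X ^ d) N * qpoch (fps_X ^ b) (fps_X ^ d) (N + e)
           * rq d (int (2 * N + e))"
proof -
  let ?p = "\<lambda>c. qpoch (fps_X ^ c) (fps_X ^ d :: int fps)"
  \<comment> \<open>Stated relative to the even case at the same \<open>n\<close>, this serves both
    inside the induction and for the final case \<open>e = 1\<close>.\<close>
  have odd: "theta_sum a b d 1 M n = ?p a n * ?p b (n + 1) * rq d (int (2 * n + 1))"
    if "n < M" "theta_sum a b d 0 M n = ?p a n * ?p b n * rq d (int (2 * n))" for n
  proof -
    have "(1 - fps_X ^ (d * Suc (2 * n))) * theta_sum a b d 1 M n = ?p a n * ?p b (n + 1) * rq d (int (2 * n))"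
      using theta_sum_odd[OF that(1), of a b] that(2) assms
      by (simp add: qpoch_Suc power_add power_mult mult_ac)
    from eq_mult_rq_Suc[OF assms(3) this] show ?thesis by simp
  qed
  have even: "theta_sum a b d 0 M N = ?p a N * ?p b N * rq d (int (2 * N))" if "N < M" for N
    using that
  proof (induction N)
    case 0
    have "theta_sum a b d 0 M 0 = (\<Sum>s\<in>{0}. theta_term a b s * (rq d (int 0 - s) * rq d (int 0 + s + int 0)))"
      unfolding theta_sum_def
    proof (rule sum.mono_neutral_right)
      show "\<forall>s\<in>{- int M..int M} - {0}. theta_term a b s * (rq d (int 0 - s) * rq d (int 0 + s + int 0)) = 0"
      proof
        fix s assume "s \<in> {- int M..int M} - {0}"
        then consider "s < 0" | "- s < 0" by force
        then show "theta_term a b s * (rq d (int 0 - s) * rq d (int 0 + s + int 0)) = 0"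
          by cases simp_all
      qed
    qed simp_all
    then show ?case using assms by (simp add: theta_term_def tri_def qpoch_def)
  next
    case (Suc n)
    have "theta_sum a b d 1 M n = ?p a n * ?p b (n + 1) * rq d (int (2 * n + 1))"
      using Suc by (intro odd) auto
    then have "(1 - fps_X ^ (d * Suc (2 * n + 1))) * theta_sum a b d 0 M (Suc n)
        = ?p a (Suc n) * ?p b (Suc n) * rq d (int (2 * n + 1))"
      using theta_sum_even[of n M a b] Suc.prems assms
      by (simp add: qpoch_Suc power_add power_mult mult_ac)
    from eq_mult_rq_Suc[OF assms(3) this] show ?case by simp
  qed
  show ?thesis
  proof (cases "e = 0")
    case True
    then show ?thesis using even[OF assms(1)] by simp
  next
    case False
    then have "e = 1" using assms by simp
    then show ?thesis using odd[OF assms(1) even[OF assms(1)]] by simp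
  qed
qed

section \<open>Two Bailey steps from the unit sum\<close>

lemma qpoch_1_Suc: "qpoch 1 q (Suc n) = 0"
  by (simp add: qpoch_def prod.lessThan_Suc_shift del: prod.lessThan_Suc)

text \<open>The change of parameters multiplies the weight by \<open>q^(s(s+e))\<close>;
  \<open>rq_bailey\<close> expands that product, and exchanging the sums leaves theta sums with the
  original weight.\<close>

lemma theta_sum_bailey:
  assumes "e \<le> 1"
  shows "theta_sum (a + 1 + e) (b + 1 - e) 1 e M N
      = (\<Sum>t\<le>N. fps_X ^ (t * (t + e)) * rq 1 (int N - int t) * theta_sum a b 1 e M t)"
proof -
  have "theta_sum (a + 1 + e) (b + 1 - e) 1 e M N
      = (\<Sum>s\<in>{- int M..int M}. \<Sum>t\<le>N. theta_term a b s * (fps_X ^ (t * (t + e)) * rq 1 (int N - int t)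
           * (rq 1 (int t - s) * rq 1 (int t + s + int e))))"
    unfolding theta_sum_def
    by (simp only: theta_term_square[OF assms, symmetric] mult.assoc[of "theta_term _ _ _"] rq_bailey[OF assms]
        sum_distrib_left)
  also have "\<dots> = (\<Sum>t\<le>N. \<Sum>s\<in>{- int M..int M}. theta_term a b s * (fps_X ^ (t * (t + e)) * rq 1 (int N - int t)
           * (rq 1 (int t - s) * rq 1 (int t + s + int e))))"
    by (rule sum.swap)
  also have "\<dots> = (\<Sum>t\<le>N. fps_X ^ (t * (t + e)) * rq 1 (int N - int t) * theta_sum a b 1 e M t)"
    unfolding theta_sum_def sum_distrib_left by (intro sum.cong) (simp_all add: mult_ac)
  finally show ?thesis .
qed

text \<open>One of the two parameters is 0, so the triple product contains
  \<open>qpoch 1 fps_X N\<close>, which vanishes for \<open>N > 0\<close>.\<close>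

lemma theta_sum_unit:
  assumes "e \<le> 1" "N < M"
  shows "theta_sum (1 - e) e 1 e M N = (if N = 0 then 1 else 0)"
proof -
  have q1: "qpoch fps_X fps_X (Suc 0) * rq 1 1 = 1"
    using qpoch_mult_rq[of 1 1] by simp
  have q0: "qpoch x y 0 = 1" for x y :: "int fps"
    by (simp add: qpoch_def)
  consider "e = 0" | "e = 1" using assms by linarith
  then show ?thesis
  proof cases
    case 1
    then show ?thesis
      using theta_sum_eq[of N M 1 0 1 0] assms by (cases N) (simp_all add: qpoch_1_Suc q0)
  next
    case 2
    then show ?thesis
      using theta_sum_eq[of N M 0 1 1 1] assms q1 by (cases N) (simp_all add: qpoch_1_Suc q0)
  qed
qed

lemma theta_sum_rogers_ramanujan:
  assumes "e \<le> 1" "N < M"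
  shows "theta_sum (3 + e) (2 - e) 1 e M N
     = (\<Sum>t\<le>N. fps_X ^ (t * (t + e)) * (rq 1 (int N - int t) * rq 1 (int t)))"
proof -
  \<comment> \<open>The first step leads from \<open>(1 - e, e)\<close> to \<open>(2, 1)\<close> for
    both values of \<open>e\<close>; only \<open>u = 0\<close> survives.\<close>
  have 1: "theta_sum 2 1 1 e M t = rq 1 (int t)" if "t < M" for t
  proof -
    have "theta_sum (1 - e + 1 + e) (e + 1 - e) 1 e M t
      = (\<Sum>u\<le>t. fps_X ^ (u * (u + e)) * rq 1 (int t - int u) * theta_sum (1 - e) e 1 e M u)"
      by (rule theta_sum_bailey[OF assms(1)])
    also have "\<dots> = (\<Sum>u\<in>{0}. fps_X ^ (u * (u + e)) * rq 1 (int t - int u) * theta_sum (1 - e) e 1 e M u)"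
      by (rule sum.mono_neutral_right) (use theta_sum_unit[OF assms(1)] that in auto)
    finally show ?thesis
      using assms theta_sum_unit[OF assms(1), of 0 M] that by (simp add: numeral_2_eq_2)
  qed
  have "theta_sum (2 + 1 + e) (1 + 1 - e) 1 e M N
      = (\<Sum>t\<le>N. fps_X ^ (t * (t + e)) * rq 1 (int N - int t) * theta_sum 2 1 1 e M t)"
    by (rule theta_sum_bailey[OF assms(1)])
  also have "\<dots> = (\<Sum>t\<le>N. fps_X ^ (t * (t + e)) * (rq 1 (int N - int t) * rq 1 (int t)))"
    using 1 assms by (intro sum.cong) (auto simp: mult_ac)
  finally show ?thesis by (simp add: numeral_eq_Suc)
qed

section \<open>Congruences modulo powers of the variable\<close>

definition fps_cong :: "nat \<Rightarrow> int fps \<Rightarrow> int fps \<Rightarrow> bool" where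
  "fps_cong K f g \<longleftrightarrow> fps_X ^ K dvd f - g"

text \<open>Limits are handled as congruences modulo every \<open>fps_X ^ K\<close>: the
  divisibility form gives compatibility with products, this coefficient form gives sums,
  transitivity and the link to convergence.\<close>

lemma fps_cong_iff: "fps_cong K f g \<longleftrightarrow> (\<forall>k<K. fps_nth f k = fps_nth g k)"
proof
  assume "fps_cong K f g"
  then obtain h where "f - g = fps_X ^ K * h"
    unfolding fps_cong_def by (elim dvdE)
  then have "fps_nth f k - fps_nth g k = (if k < K then 0 else fps_nth h (k - K))" for k
    by (metis fps_sub_nth fps_X_power_mult_nth)
  then show "\<forall>k<K. fps_nth f k = fps_nth g k"
    by (metis eq_iff_diff_eq_0)
next
  assume "\<forall>k<K. fps_nth f k = fps_nth g k"
  then have "f - g = fps_X ^ K * Abs_fps (\<lambda>n. fps_nth (f - g) (n + K))"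
    by (intro fps_ext) (simp add: fps_X_power_mult_nth)
  then show "fps_cong K f g"
    unfolding fps_cong_def by (rule dvdI)
qed

lemma fps_cong_eqI: "(\<And>K. fps_cong K f g) \<Longrightarrow> f = g"
  unfolding fps_cong_iff by (blast intro: fps_ext)

lemma fps_cong_refl [simp]: "fps_cong K f f"
  and fps_cong_sym: "fps_cong K f g \<Longrightarrow> fps_cong K g f"
  and fps_cong_trans [trans]: "fps_cong K f g \<Longrightarrow> fps_cong K g h \<Longrightarrow> fps_cong K f h"
  and fps_cong_sum: "(\<And>x. x \<in> A \<Longrightarrow> fps_cong K (u x) (v x)) \<Longrightarrow> fps_cong K (sum u A) (sum v A)"
  unfolding fps_cong_iff by (simp_all add: fps_sum_nth)

lemma fps_cong_mult:
  assumes "fps_cong K f g" "fps_cong K f' g'"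
  shows "fps_cong K (f * f') (g * g')"
proof -
  have "f * f' - g * g' = (f - g) * f' + g * (f' - g')" by (simp add: algebra_simps)
  then show ?thesis using assms by (simp add: fps_cong_def)
qed

lemma fps_cong_X_power_0: "K \<le> n \<Longrightarrow> fps_cong K (fps_X ^ n * f) 0"
  unfolding fps_cong_def by (simp add: le_imp_power_dvd dvd_mult2)

text \<open>Every factor of index \<open>j \<ge> N\<close> is 1 modulo \<open>fps_X ^ K\<close>,
  since \<open>c + d * j \<ge> K\<close>.\<close>

lemma qpoch_cong:
  assumes "c > 0" "d > 0" "K \<le> N" "N \<le> n"
  shows "fps_cong K (qpoch (fps_X ^ c) (fps_X ^ d) n) (qpoch (fps_X ^ c) (fps_X ^ d) N)"
  using assms(4)
proof (induction n rule: dec_induct)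
  case (step n)
  have "n \<le> d * n" using assms by (cases d) auto
  then have "fps_cong K (fps_X ^ (c + d * n) * qpoch (fps_X ^ c) (fps_X ^ d) n) 0"
    using assms step.hyps by (intro fps_cong_X_power_0) linarith
  then have "fps_cong K (qpoch (fps_X ^ c) (fps_X ^ d) (Suc n)) (qpoch (fps_X ^ c) (fps_X ^ d) n)"
    by (simp add: qpoch_Suc fps_cong_def power_add power_mult algebra_simps)
  then show ?case using step.IH by (rule fps_cong_trans)
qed simp

lemma qpoch_inf_cong:
  assumes "c > 0" "d > 0" "K \<le> N"
  shows "fps_cong K (qpoch (fps_X ^ c) (fps_X ^ d) N) (qpoch_inf (fps_X ^ c) (fps_X ^ d))"
  unfolding fps_cong_iff
proof (intro allI impI)
  fix k assume k: "k < K"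
  let ?p = "qpoch_inf (fps_X ^ c) (fps_X ^ d :: int fps)"
  \<comment> \<open>A nonzero value excludes the case of \<open>has_prod\<close> with vanishing
    factors, so the partial products themselves converge to \<open>?p\<close>.\<close>
  have "?p \<noteq> 0"
    using has_prod_qpoch_inf(2)[OF assms(1,2)] by auto
  then have "(\<lambda>n. \<Prod>j\<le>n. 1 - fps_X ^ c * (fps_X ^ d) ^ j) \<longlonglongrightarrow> ?p"
    using has_prod_qpoch_inf(1)[OF assms(1,2)] by (simp add: has_prod_def raw_has_prod_def)
  then have "\<forall>\<^sub>F n in sequentially. fps_nth (\<Prod>j\<le>n. 1 - fps_X ^ c * (fps_X ^ d) ^ j) k = fps_nth ?p k"
    by (simp add: tendsto_fps_iff)
  then obtain n0 where n0: "\<And>n. n \<ge> n0 \<Longrightarrow> fps_nth (qpoch (fps_X ^ c) (fps_X ^ d) (Suc n)) k = fps_nth ?p k"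
    by (auto simp: eventually_sequentially qpoch_def lessThan_Suc_atMost)
  have "fps_cong K (qpoch (fps_X ^ c) (fps_X ^ d) (Suc (n0 + N))) (qpoch (fps_X ^ c) (fps_X ^ d) N)"
    using assms by (intro qpoch_cong) auto
  then show "fps_nth (qpoch (fps_X ^ c) (fps_X ^ d) N) k = fps_nth ?p k"
    using n0[of "n0 + N"] k by (simp add: fps_cong_iff)
qed

lemma suminf_cong_sum:
  fixes f :: "nat \<Rightarrow> int fps"
  assumes "summable f" "\<And>n. n > N \<Longrightarrow> fps_cong K (f n) 0"
  shows "fps_cong K (suminf f) (\<Sum>n\<le>N. f n)"
  unfolding fps_cong_iff
proof (intro allI impI)
  fix k assume k: "k < K"
  have "(\<lambda>n. \<Sum>i<n. f i) \<longlonglongrightarrow> suminf f"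
    using assms(1) by (rule summable_LIMSEQ)
  then have "\<forall>\<^sub>F n in sequentially. fps_nth (\<Sum>i<n. f i) k = fps_nth (suminf f) k"
    by (simp add: tendsto_fps_iff)
  then obtain n0 where n0: "\<And>n. n \<ge> n0 \<Longrightarrow> fps_nth (\<Sum>i<n. f i) k = fps_nth (suminf f) k"
    by (auto simp: eventually_sequentially)
  have "fps_nth (\<Sum>i<n0 + Suc N. f i) k = fps_nth (\<Sum>i\<le>N. f i) k"
    unfolding fps_sum_nth
    by (rule sum.mono_neutral_right) (use assms(2) k in \<open>auto simp: fps_cong_iff\<close>)
  then show "fps_nth (suminf f) k = fps_nth (\<Sum>n\<le>N. f n) k"
    using n0[of "n0 + Suc N"] by simp
qed

section \<open>Letting \<open>N\<close> tend to infinity\<close>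

definition rq_inf :: "nat \<Rightarrow> int fps" where
  "rq_inf d = fps_recip (qpoch_inf (fps_X ^ d) (fps_X ^ d))"

lemma qpoch_inf_mult_rq_inf:
  "d > 0 \<Longrightarrow> qpoch_inf (fps_X ^ d) (fps_X ^ d) * rq_inf d = 1"
  unfolding rq_inf_def by (intro fps_recip_mult has_prod_qpoch_inf(2))

lemma rq_cong:
  assumes "d > 0" "int K \<le> n"
  shows "fps_cong K (rq d n) (rq_inf d)"
proof -
  obtain N where n: "n = int N" using assms(2) by (metis nonneg_int_cases of_nat_0_le_iff order_trans)
  let ?p = "qpoch (fps_X ^ d) (fps_X ^ d) N :: int fps" and ?q = "qpoch_inf (fps_X ^ d) (fps_X ^ d) :: int fps"
  \<comment> \<open>Congruent series have congruent reciprocals: multiply \<open>?q\<close> and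
    \<open>?p\<close> by both reciprocals and cancel.\<close>
  have "fps_cong K (rq d n * ?q * rq_inf d) (rq d n * ?p * rq_inf d)"
    using assms by (intro fps_cong_mult fps_cong_sym[OF qpoch_inf_cong]) (simp_all add: n)
  moreover have "rq d n * ?q * rq_inf d = rq d n"
    using qpoch_inf_mult_rq_inf[OF assms(1)] by (simp add: mult.assoc)
  moreover have "rq d n * ?p * rq_inf d = rq_inf d"
    using qpoch_mult_rq[OF assms(1), of N] by (simp add: n mult.commute)
  ultimately show ?thesis by simp
qed

text \<open>The exponent is at least \<open>tri s + tri (- s) = s^2\<close>, which is at least
  \<open>\<bar>s\<bar>\<close>.\<close>

lemma theta_term_cong_0:
  assumes "a > 0" "b > 0" "int K \<le> \<bar>s\<bar>"
  shows "fps_cong K (theta_term a b s * f) 0"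
proof -
  have "2 * (int (tri s) + int (tri (- s))) = 2 * (s * s)"
    unfolding distrib_left[of 2] int_tri by (simp add: algebra_simps)
  then have sq: "int (tri s + tri (- s)) = s * s" by simp
  have "\<bar>s\<bar> \<le> \<bar>s\<bar> * \<bar>s\<bar>"
    by (cases "s = 0") (simp_all only: mult_le_cancel_left1, auto)
  then have "int K \<le> int (tri s + tri (- s))"
    unfolding sq using assms(3) by simp
  then have "K \<le> tri s + tri (- s)"
    by (simp only: of_nat_le_iff)
  also have "\<dots> \<le> a * tri s + b * tri (- s)"
    using assms by (intro add_mono) auto
  finally have "K \<le> a * tri s + b * tri (- s)" .
  then have "fps_cong K (fps_X ^ (a * tri s + b * tri (- s)) * ((if even s then 1 else - 1) * f)) 0"
    by (rule fps_cong_X_power_0)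
  then show ?thesis by (simp add: theta_term_def mult_ac)
qed

text \<open>For \<open>\<bar>s\<bar> < K\<close> both \<open>rq\<close> arguments are at least
  \<open>K\<close> because \<open>N \<ge> 2 * K\<close>; the remaining terms are 0 modulo
  \<open>fps_X ^ K\<close> on both sides.\<close>

lemma theta_sum_cong:
  assumes "a > 0" "b > 0" "d > 0" "2 * K \<le> N"
  shows "fps_cong K (theta_sum a b d e M N)
    (rq_inf d * rq_inf d * (\<Sum>s\<in>{- int M..int M}. theta_term a b s))"
  unfolding theta_sum_def sum_distrib_left
proof (rule fps_cong_sum)
  fix s
  show "fps_cong K (theta_term a b s * (rq d (int N - s) * rq d (int N + s + int e)))
      (rq_inf d * rq_inf d * theta_term a b s)"
  proof (cases "\<bar>s\<bar> < int K")
    case True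
    then show ?thesis
      using assms unfolding mult.commute[of _ "theta_term a b s"]
      by (intro fps_cong_mult rq_cong fps_cong_refl) auto
  next
    case False
    then have "fps_cong K (theta_term a b s * f) 0" for f
      using assms by (intro theta_term_cong_0) auto
    then show ?thesis
      unfolding mult.commute[of _ "theta_term a b s"]
      by (blast intro: fps_cong_trans fps_cong_sym)
  qed
qed

text \<open>The same truncated theta series \<open>T\<close> is evaluated in two ways modulo
  \<open>fps_X ^ K\<close>, by the Bailey steps with \<open>d = 1\<close> and by the triple product
  with \<open>d = 5 = a + b\<close>, and is then eliminated. The cases \<open>e = 0\<close> and
  \<open>e = 1\<close> concern \<open>RR_G\<close> and \<open>RR_H\<close>.\<close>

lemma rogers_ramanujan_sum:
  assumes "e \<le> 1" "a = 3 + e" "b = 2 - e" "summable (\<lambda>n. fps_X ^ (n * (n + e)) * rq 1 (int n))"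
  shows "(\<Sum>n. fps_X ^ (n * (n + e)) * rq 1 (int n))
    = rq_inf 1 * (qpoch_inf (fps_X ^ a) (fps_X ^ 5) * qpoch_inf (fps_X ^ b) (fps_X ^ 5)
        * qpoch_inf (fps_X ^ 5) (fps_X ^ 5))"
    (is "?S = rq_inf 1 * (?A * ?B * ?Q)")
proof (rule fps_cong_eqI)
  fix K
  \<comment> \<open>With \<open>N = 2 * K\<close> the index \<open>N - t\<close> is still at least
    \<open>K\<close> for every \<open>t \<le> K\<close>; terms with \<open>t > K\<close> vanish
    modulo \<open>fps_X ^ K\<close>.\<close>
  define N M where "N = 2 * K" and "M = Suc N"
  define T where "T = (\<Sum>s\<in>{- int M..int M}. theta_term a b s)"
  have ab: "a > 0" "b > 0" using assms by auto
  let ?t = "\<lambda>n. fps_X ^ (n * (n + e)) * rq 1 (int n)"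
  have high: "fps_cong K (fps_X ^ (t * (t + e)) * f) 0" if "t > K" for t f
  proof (rule fps_cong_X_power_0)
    have "K * 1 \<le> t * (t + e)" using that by (intro mult_mono) auto
    then show "K \<le> t * (t + e)" by simp
  qed
  have "fps_cong K (rq_inf 1 * ?S) (rq_inf 1 * (\<Sum>t\<le>N. ?t t))"
    by (intro fps_cong_mult suminf_cong_sum assms(4) high fps_cong_refl) (simp add: N_def)
  also have "fps_cong K \<dots> (\<Sum>t\<le>N. fps_X ^ (t * (t + e)) * (rq 1 (int N - int t) * rq 1 (int t)))"
    unfolding sum_distrib_left mult.left_commute[of "rq_inf 1"]
  proof (rule fps_cong_sum)
    fix t
    show "fps_cong K (fps_X ^ (t * (t + e)) * (rq_inf 1 * rq 1 (int t)))
       (fps_X ^ (t * (t + e)) * (rq 1 (int N - int t) * rq 1 (int t)))"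
    proof (cases "t > K")
      case True
      then show ?thesis by (blast intro: high fps_cong_trans fps_cong_sym)
    next
      case False
      then show ?thesis
        by (intro fps_cong_mult fps_cong_sym[OF rq_cong] fps_cong_refl) (simp_all add: N_def)
    qed
  qed
  also have "\<dots> = theta_sum a b 1 e M N"
    using theta_sum_rogers_ramanujan[of e N M] assms by (simp add: M_def)
  also have "fps_cong K \<dots> (rq_inf 1 * rq_inf 1 * T)"
    unfolding T_def using ab by (intro theta_sum_cong) (auto simp: N_def)
  finally have "fps_cong K (rq_inf 1 * ?S) (rq_inf 1 * rq_inf 1 * T)" .
  \<comment> \<open>Multiplying by \<open>(q; q)_inf\<close> cancels one factor
    \<open>rq_inf 1\<close>.\<close>
  then have "fps_cong K (qpoch_inf (fps_X ^ 1) (fps_X ^ 1) * (rq_inf 1 * ?S))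
      (qpoch_inf (fps_X ^ 1) (fps_X ^ 1) * (rq_inf 1 * rq_inf 1 * T))"
    by (rule fps_cong_mult[OF fps_cong_refl])
  then have S: "fps_cong K ?S (rq_inf 1 * T)"
    using qpoch_inf_mult_rq_inf[of 1] by (simp flip: mult.assoc)
  have "fps_cong K (rq_inf 5 * rq_inf 5 * T) (theta_sum a b 5 0 M N)"
    unfolding T_def using ab by (intro fps_cong_sym[OF theta_sum_cong]) (auto simp: N_def)
  also have "\<dots> = qpoch (fps_X ^ a) (fps_X ^ 5) N * qpoch (fps_X ^ b) (fps_X ^ 5) N * rq 5 (int (2 * N))"
    using theta_sum_eq[of N M a b 5 0] assms by (simp add: M_def)
  also have "fps_cong K \<dots> (?A * ?B * rq_inf 5)"
    using ab by (intro fps_cong_mult rq_cong qpoch_inf_cong) (auto simp: N_def)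
  \<comment> \<open>Multiplying by \<open>?Q * ?Q\<close> cancels both copies of
    \<open>rq_inf 5\<close> on the left and leaves one factor \<open>?Q\<close> on the
    right.\<close>
  finally have "fps_cong K (?Q * ?Q * (rq_inf 5 * rq_inf 5 * T)) (?Q * ?Q * (?A * ?B * rq_inf 5))"
    by (rule fps_cong_mult[OF fps_cong_refl])
  moreover have "?Q * ?Q * (rq_inf 5 * rq_inf 5 * T) = (?Q * rq_inf 5) * (?Q * rq_inf 5) * T"
    and "?Q * ?Q * (?A * ?B * rq_inf 5) = (?Q * rq_inf 5) * (?A * ?B * ?Q)"
    by (simp_all only: mult_ac)
  ultimately have "fps_cong K T (?A * ?B * ?Q)"
    using qpoch_inf_mult_rq_inf[of 5] by simp
  then have "fps_cong K (rq_inf 1 * T) (rq_inf 1 * (?A * ?B * ?Q))"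
    by (rule fps_cong_mult[OF fps_cong_refl])
  with S show "fps_cong K ?S (rq_inf 1 * (?A * ?B * ?Q))" by (rule fps_cong_trans)
qed

section \<open>Dissection by residues modulo 5, and the two identities\<close>

lemma qpoch_dissect_5:
  fixes q :: "'a::comm_ring_1"
  shows "qpoch q q (5 * N) = qpoch q (q ^ 5) N * qpoch (q ^ 2) (q ^ 5) N * qpoch (q ^ 3) (q ^ 5) N
    * qpoch (q ^ 4) (q ^ 5) N * qpoch (q ^ 5) (q ^ 5) N"
proof (induction N)
  case (Suc N)
  obtain x where x: "q ^ (5 * N) = x" "(q ^ 5) ^ N = x"
    by (simp add: power_mult)
  have "5 * Suc N = Suc (Suc (Suc (Suc (Suc (5 * N)))))" by simp
  then have "qpoch q q (5 * Suc N) = qpoch q q (5 * N) * (1 - q * (q ^ 5) ^ N) * (1 - q ^ 2 * (q ^ 5) ^ N)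
      * (1 - q ^ 3 * (q ^ 5) ^ N) * (1 - q ^ 4 * (q ^ 5) ^ N) * (1 - q ^ 5 * (q ^ 5) ^ N)"
    by (simp only: qpoch_Suc power_Suc x) (simp add: numeral_eq_Suc mult.assoc)
  then show ?case
    unfolding Suc.IH by (simp only: qpoch_Suc mult_ac)
qed (simp add: qpoch_def)

text \<open>Modulo \<open>fps_X ^ K\<close> it suffices to take \<open>5 * K\<close> factors, that
  is \<open>K\<close> factors from each residue class.\<close>

lemma qpoch_inf_dissect_5:
  "qpoch_inf fps_X fps_X = (qpoch_inf fps_X (fps_X ^ 5) * qpoch_inf (fps_X ^ 2) (fps_X ^ 5)
     * qpoch_inf (fps_X ^ 3) (fps_X ^ 5) * qpoch_inf (fps_X ^ 4) (fps_X ^ 5)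
     * qpoch_inf (fps_X ^ 5) (fps_X ^ 5) :: int fps)" (is "_ = ?P")
proof (rule fps_cong_eqI)
  fix K
  have inf: "fps_cong K (qpoch (fps_X ^ c) (fps_X ^ d) N) (qpoch_inf (fps_X ^ c) (fps_X ^ d))"
    if "c > 0" "d > 0" "K \<le> N" for c d N
    using that by (rule qpoch_inf_cong)
  have "fps_cong K (qpoch_inf fps_X fps_X) (qpoch fps_X fps_X (5 * K))"
    using inf[of 1 1 "5 * K"] by (simp add: fps_cong_sym)
  also have "fps_cong K \<dots> ?P"
    unfolding qpoch_dissect_5 using inf[of 1 5 K]
    by (intro fps_cong_mult inf) auto
  finally show "fps_cong K (qpoch_inf fps_X fps_X) ?P" .
qed

theorem theorem1p1p2:
  shows "RR_G = fps_recip (qpoch_inf fps_X (fps_X ^ 5) * qpoch_inf (fps_X ^ 4) (fps_X ^ 5))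
       \<and> RR_H = fps_recip (qpoch_inf (fps_X ^ 2) (fps_X ^ 5) * qpoch_inf (fps_X ^ 3) (fps_X ^ 5))"
proof -
  let ?P = "\<lambda>c. qpoch_inf (fps_X ^ c) (fps_X ^ 5) :: int fps"
  have rq: "rq 1 (int n) = fps_recip (qpoch fps_X fps_X n)" for n
    by (simp add: rq_def)
  have nth0: "fps_nth (?P c * ?P c') 0 = 1" if "c > 0" "c' > 0" for c c'
    using that has_prod_qpoch_inf(2)[of _ 5] by simp
  have prod: "rq_inf 1 * (?P 1 * ?P 2 * ?P 3 * ?P 4 * ?P 5) = 1"
    using qpoch_inf_mult_rq_inf[of 1] qpoch_inf_dissect_5 by (simp add: mult.commute)
  \<comment> \<open>The classes 2, 3 and 5 appear in the numerator; multiplying by the classes 1 and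
    4 completes \<open>(q; q)_inf\<close>, which cancels \<open>rq_inf 1\<close> by
    \<open>prod\<close>.\<close>
  have G0: "RR_G = rq_inf 1 * (?P 3 * ?P 2 * ?P 5)"
    using rogers_ramanujan_sum[of 0 3 2] summable_RR_G
    unfolding RR_G_def rq power2_eq_square by simp
  have "?P 1 * ?P 4 * RR_G = rq_inf 1 * (?P 1 * ?P 2 * ?P 3 * ?P 4 * ?P 5)"
    by (simp only: G0 mult_ac)
  then have G: "RR_G = fps_recip (?P 1 * ?P 4)"
    using nth0[of 1 4] unfolding prod by (intro fps_recip_unique) auto
  \<comment> \<open>Now the classes 1, 4 and 5 appear, and 2 and 3 are the missing ones.\<close>
  have H0: "RR_H = rq_inf 1 * (?P 4 * ?P 1 * ?P 5)"
    using rogers_ramanujan_sum[of 1 4 1] summable_RR_H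
    unfolding RR_H_def rq by simp
  have "?P 2 * ?P 3 * RR_H = rq_inf 1 * (?P 1 * ?P 2 * ?P 3 * ?P 4 * ?P 5)"
    by (simp only: H0 mult_ac)
  then have H: "RR_H = fps_recip (?P 2 * ?P 3)"
    using nth0[of 2 3] unfolding prod by (intro fps_recip_unique) auto
  show ?thesis using G H by simp
qed

end
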